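(* The coverage measure $I_C$ is outlier consistent.
   Context: For $x,y\in\mathbb{R}^d$, $y$ dominates $x$ if $x_i\le y_i$ for all $i\in[d]$ and $x_j<y_j$ for some $j\in[d]$. A set of alternatives is a finite set $A\subseteq\mathbb{R}^d$ ($d\ge 1$ arbitrary) none of whose elements is dominated by another element of $A$. Let $\|x-y\|=\sum_{i=1}^d|x_i-y_i|$. For nonempty $S\subseteq A$, $I_C(S,A)=\max_{a\in A}\min_{s\in S}\|a-s\|$ (lower is better). For a positive integer $k$, $\mathcal{S}(I_C,A,k)$ is the set of all $S\subseteq A$ with $|S|=k$ minimizing $I_C(S,A)$ among the size-$k$ subsets of $A$. An alternative $x\in A$ is an outlier alternative if $\min_{a\in A\setminus\{x\}}\|x-a\|>\max_{y,z\in A\setminus\{x\}}\|y-z\|$. A measure $I$ is outlier consistent if for any $k\ge 2$ and any set of alternatives $A$ containing an outlier alternative $x\in A$, we have $x\in S$ for each $S\in\mathcal{S}(I,A,k)$. *)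

theory Defs
  imports "HOL-Analysis.Finite_Cartesian_Product"
begin

definition dominates :: "real ^ 'd \<Rightarrow> real ^ 'd \<Rightarrow> bool" where
  "dominates y x \<longleftrightarrow> (\<forall>i. x $ i \<le> y $ i) \<and> (\<exists>j. x $ j < y $ j)"

definition alternatives :: "(real ^ 'd) set \<Rightarrow> bool" where
  "alternatives A \<longleftrightarrow> finite A \<and> (\<forall>x\<in>A. \<forall>y\<in>A. \<not> dominates y x)"

text \<open>The distance is the one induced by the 1-norm; the library's \<open>dist\<close> and \<open>norm\<close> on
  \<open>real ^ 'd\<close> are Euclidean.\<close>

definition l1_dist :: "real ^ 'd \<Rightarrow> real ^ 'd \<Rightarrow> real" where
  "l1_dist x y = (\<Sum>i\<in>UNIV. \<bar>x $ i - y $ i\<bar>)"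

definition coverage :: "(real ^ 'd) set \<Rightarrow> (real ^ 'd) set \<Rightarrow> real" where
  "coverage S A = (MAX a\<in>A. MIN s\<in>S. l1_dist a s)"

text \<open>A measure maps \<open>S\<close> and \<open>A\<close> to a real number, lower values being better.\<close>

definition optimal_subsets ::
    "((real ^ 'd) set \<Rightarrow> (real ^ 'd) set \<Rightarrow> real) \<Rightarrow> (real ^ 'd) set \<Rightarrow> nat \<Rightarrow> (real ^ 'd) set set" where
  "optimal_subsets I A k = {S. is_arg_min (\<lambda>T. I T A) (\<lambda>T. T \<subseteq> A \<and> card T = k) S}"

text \<open>For \<open>A = {x}\<close> both sides below are extrema over the empty set and hence unspecified. This
  does not affect \<open>outlier_consistent\<close>, since a singleton has no subset of size \<open>k \<ge> 2\<close>.\<close>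

definition outlier :: "(real ^ 'd) set \<Rightarrow> real ^ 'd \<Rightarrow> bool" where
  "outlier A x \<longleftrightarrow> x \<in> A \<and>
     (MIN a\<in>A - {x}. l1_dist x a) > (MAX (y, z)\<in>(A - {x}) \<times> (A - {x}). l1_dist y z)"

definition outlier_consistent ::
    "((real ^ 'd) set \<Rightarrow> (real ^ 'd) set \<Rightarrow> real) \<Rightarrow> bool" where
  "outlier_consistent I \<longleftrightarrow>
     (\<forall>k\<ge>2. \<forall>A x. alternatives A \<and> outlier A x \<longrightarrow> (\<forall>S\<in>optimal_subsets I A k. x \<in> S))"

end

theory Submission
  imports Defs
begin

text \<open>A size-\<open>k\<close> set \<open>S\<close> that omits the outlier \<open>x\<close> leaves \<open>x\<close> farther away than the diameter of
  \<open>A - {x}\<close>. Exchanging any element of \<open>S\<close> for \<open>x\<close> keeps some other element of \<open>S\<close>, because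
  \<open>k \<ge> 2\<close>, and this element covers all of \<open>A - {x}\<close> within that diameter.\<close>

lemma l1_dist_self [simp]: "l1_dist x x = 0"
  by (simp add: l1_dist_def)

text \<open>Turns the nested extrema into quantifiers, so that a bound on \<open>coverage\<close>
  amounts to naming a near enough \<open>s\<close> for each \<open>a\<close>.\<close>

lemma coverage_le_iff:
  assumes "finite A" "A \<noteq> {}" "finite S" "S \<noteq> {}"
  shows "coverage S A \<le> r \<longleftrightarrow> (\<forall>a\<in>A. \<exists>s\<in>S. l1_dist a s \<le> r)"
  using assms by (simp add: coverage_def Min_le_iff)

text \<open>The witness \<open>r\<close> is the diameter of \<open>A - {x}\<close>. Nonemptiness
  supplies a point whose distance 0 to itself gives \<open>r \<ge> 0\<close>.\<close>

lemma outlierD: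
  assumes "finite A" "outlier A x" "A - {x} \<noteq> {}"
  obtains r where "r \<ge> 0" "\<And>y z. y \<in> A - {x} \<Longrightarrow> z \<in> A - {x} \<Longrightarrow> l1_dist y z \<le> r"
    "\<And>a. a \<in> A - {x} \<Longrightarrow> r < l1_dist x a"
proof
  let ?B = "A - {x}"
  let ?r = "MAX (y, z)\<in>?B \<times> ?B. l1_dist y z"
  have fin: "finite ?B" using assms by simp
  show le: "l1_dist y z \<le> ?r" if "y \<in> ?B" "z \<in> ?B" for y z
    using fin that by (intro Max_ge) (auto intro!: image_eqI[of _ _ "(y, z)"])
  show "?r < l1_dist x a" if "a \<in> ?B" for a
  proof -
    have "(MIN a\<in>?B. l1_dist x a) \<le> l1_dist x a"
      using fin that by (intro Min_le) auto
    then show ?thesis using assms(2) unfolding outlier_def by linarith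
  qed
  obtain b where "b \<in> ?B" using assms(3) by blast
  then show "0 \<le> ?r" using le[of b b] by simp
qed

theorem proposition21:
  shows "outlier_consistent (coverage :: (real ^ 'd) set \<Rightarrow> (real ^ 'd) set \<Rightarrow> real)"
  unfolding outlier_consistent_def
proof (intro allI impI ballI, elim conjE, rule ccontr)
  fix k :: nat and A S :: "(real ^ 'd) set" and x
  assume k: "2 \<le> k" and "alternatives A" and out: "outlier A x"
    and S: "S \<in> optimal_subsets coverage A k" and xS: "x \<notin> S"
  then have finA: "finite A" and xA: "x \<in> A"
    by (auto simp: alternatives_def outlier_def)
  have SA: "S \<subseteq> A" and cardS: "card S = k"
    and opt: "\<And>T. T \<subseteq> A \<Longrightarrow> card T = k \<Longrightarrow> \<not> coverage T A < coverage S A"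
    using S by (auto simp: optimal_subsets_def is_arg_min_def)
  have finS: "finite S" using SA finA finite_subset by blast
  \<comment> \<open>\<open>s\<close> will give way to \<open>x\<close>, while \<open>t\<close> stays
    to cover \<open>A - {x}\<close>.\<close>
  obtain s t where st: "s \<in> S" "t \<in> S" "s \<noteq> t"
    using k cardS finS by (metis card_le_Suc0_iff_eq not_less_eq_eq numeral_2_eq_2)
  have SB: "S \<subseteq> A - {x}" using SA xS by blast
  then obtain r where r: "r \<ge> 0" "\<And>y z. y \<in> A - {x} \<Longrightarrow> z \<in> A - {x} \<Longrightarrow> l1_dist y z \<le> r"
    "\<And>a. a \<in> A - {x} \<Longrightarrow> r < l1_dist x a"
    using outlierD[OF finA out] st by blast
  define T where "T = insert x (S - {s})"
  have "card T = k"
    using finS st xS cardS k by (simp add: T_def)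
  moreover have "T \<subseteq> A" using SA xA by (auto simp: T_def)
  ultimately have "coverage S A \<le> coverage T A" using opt[of T] by simp
  also have "coverage T A \<le> r"
  proof (subst coverage_le_iff)
    show "\<forall>a\<in>A. \<exists>u\<in>T. l1_dist a u \<le> r"
    proof
      fix a assume "a \<in> A"
      show "\<exists>u\<in>T. l1_dist a u \<le> r"
      proof (cases "a = x")
        case True
        \<comment> \<open>The outlier covers itself at distance 0, which is within \<open>r\<close>
          because \<open>r \<ge> 0\<close>.\<close>
        then show ?thesis using r(1) by (auto simp: T_def)
      next
        case False
        then have "l1_dist a t \<le> r" using r(2) \<open>a \<in> A\<close> st SB by blast
        then show ?thesis using st by (auto simp: T_def)
      qed
    qed
  qed (use finA xA finS in \<open>auto simp: T_def\<close>)
  \<comment> \<open>The bound \<open>coverage S A \<le> r\<close> is read at the point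
    \<open>x\<close>: it puts some \<open>u\<close> of \<open>S\<close>, hence of
    \<open>A - {x}\<close>, within \<open>r\<close> of the outlier.\<close>
  finally obtain u where "u \<in> S" "l1_dist x u \<le> r"
    using coverage_le_iff[of A S r] finA xA finS st by blast
  then show False using r(3)[of u] SB by force
qed

end
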